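(* Let $Q=\{q_0,q_1\}$ and $S=\{0,1\}$, and consider all Mealy automata $(Q,S,\varphi,\psi)$ (there are $256$ of them). Exactly $24$ of them are bijective. Among these bijective automata, exactly $20$ are transitive, exactly $6$ are particle-preserving, and exactly $5$ are both transitive and particle-preserving, namely MA-$[2,2,5,3]$, MA-$[2,2,6,5]$, MA-$[2,2,9,5]$, MA-$[2,2,10,12]$ and MA-$[2,2,12,5]$. The automata MA-$[2,2,6,5]$, MA-$[2,2,9,5]$, MA-$[2,2,12,5]$ act identically on binary words and are not minimal, while MA-$[2,2,5,3]$ and MA-$[2,2,10,12]$ are minimal and are obtained from each other by exchanging the two states $q_0$ and $q_1$. Hence, up to exchanging the states, MA-$[2,2,5,3]$ is the only automaton with these $Q$ and $S$ that is bijective, transitive, particle-preserving and minimal.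
   Context: A Mealy automaton $(Q,S,\varphi,\psi)$ consists of a non-empty set of states $Q$, a non-empty alphabet $S$, a transition function $\varphi:Q\times S\to Q$ and an exit function $\psi:Q\times S\to S$. Both extend to words: for $\bm{s}=s_1\cdots s_n\in S^*$ put $p_1=q$, $p_{j+1}=\varphi(p_j,s_j)$; then $\varphi(q,\bm{s})=p_{n+1}\in Q$ and $\psi(q,\bm{s})=\psi(p_1,s_1)\cdots\psi(p_n,s_n)\in S^n$. $S^*$ is the set of all finite words over $S$, including the empty word. The automaton acts identically on words if $\psi(q,\bm{s})=\bm{s}$ for all $q\in Q$, $\bm{s}\in S^*$. The automaton is: - bijective if $(q,s)\mapsto(\varphi(q,s),\psi(q,s))$ is a bijection of $Q\times S$; - transitive if for all $q,q'\in Q$ there is a word $\bm{s}\in S^*$ with $\varphi(q,\bm{s})=q'$; - particle-preserving if there is a weight function $w:Q\cup S\to\mathbb{R}$ ($Q$ and $S$ regarded as disjoint), not constant on $S$, with $w(q)+w(s)=w(\varphi(q,s))+w(\psi(q,s))$ for all $(q,s)\in Q\times S$; - minimal if for any distinct $q,r\in Q$ there is $\bm{s}\in S^*$ with $\psi(q,\bm{s})\neq\psi(r,\bm{s})$. Relabelling the states by a permutation $\sigma$ of $Q$ turns $(Q,S,\varphi,\psi)$ into $(Q,S,\tilde\varphi,\tilde\psi)$ with $\tilde\varphi(q,s)=\sigma(\varphi(\sigma^{-1}(q),s))$ and $\tilde\psi(q,s)=\psi(\sigma^{-1}(q),s)$. MA-$[m,n,k,l]$ denotes the automaton with $Q=\{q_0,\dots,q_{m-1}\}$,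 $S=\{0,\dots,n-1\}$, $\varphi(q_i,j)=q_{f(i,j)}$, $\psi(q_i,j)=g(i,j)$, where $f(i,j)\in\{0,\dots,m-1\}$ and $g(i,j)\in\{0,\dots,n-1\}$ are the digits in $k=\sum_{i=0}^{m-1}\sum_{j=0}^{n-1}f(i,j)\,m^{mn-in-j-1}$ and $l=\sum_{i=0}^{m-1}\sum_{j=0}^{n-1}g(i,j)\,n^{mn-in-j-1}$. *)

theory Defs
  imports Complex_Main "HOL-Library.FuncSet" "HOL-Combinatorics.Permutations"
begin

record ('q, 's) mealy =
  states :: "'q set"
  alphabet :: "'s set"
  trans_fun :: "'q \<times> 's \<Rightarrow> 'q"
  exit_fun :: "'q \<times> 's \<Rightarrow> 's"

text \<open>The two functions are extensional (constantly undefined outside the product of the states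
  and the alphabet), so that equal automata are equal records and automata can be counted.\<close>

definition mealy_automaton :: "('q, 's) mealy \<Rightarrow> bool" where
  "mealy_automaton A \<longleftrightarrow>
     states A \<noteq> {} \<and> alphabet A \<noteq> {} \<and>
     trans_fun A \<in> states A \<times> alphabet A \<rightarrow>\<^sub>E states A \<and>
     exit_fun A \<in> states A \<times> alphabet A \<rightarrow>\<^sub>E alphabet A"

definition mealy_automata :: "'q set \<Rightarrow> 's set \<Rightarrow> ('q, 's) mealy set" where
  "mealy_automata Q S = {A. mealy_automaton A \<and> states A = Q \<and> alphabet A = S}"

primrec trans_word :: "('q, 's) mealy \<Rightarrow> 'q \<Rightarrow> 's list \<Rightarrow> 'q" where
  "trans_word A q [] = q"
| "trans_word A q (s # u) = trans_word A (trans_fun A (q, s)) u"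

primrec exit_word :: "('q, 's) mealy \<Rightarrow> 'q \<Rightarrow> 's list \<Rightarrow> 's list" where
  "exit_word A q [] = []"
| "exit_word A q (s # u) = exit_fun A (q, s) # exit_word A (trans_fun A (q, s)) u"

definition acts_identically :: "('q, 's) mealy \<Rightarrow> bool" where
  "acts_identically A \<longleftrightarrow>
     (\<forall>q\<in>states A. \<forall>u\<in>lists (alphabet A). exit_word A q u = u)"

definition bijective :: "('q, 's) mealy \<Rightarrow> bool" where
  "bijective A \<longleftrightarrow>
     bij_betw (\<lambda>(q, s). (trans_fun A (q, s), exit_fun A (q, s)))
       (states A \<times> alphabet A) (states A \<times> alphabet A)"

definition transitive :: "('q, 's) mealy \<Rightarrow> bool" where
  "transitive A \<longleftrightarrow>
     (\<forall>q\<in>states A. \<forall>q'\<in>states A. \<exists>u\<in>lists (alphabet A). trans_word A q u = q')"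

text \<open>The sum type keeps states and letters disjoint even when both are numbers.\<close>

definition particle_preserving :: "('q, 's) mealy \<Rightarrow> bool" where
  "particle_preserving A \<longleftrightarrow>
     (\<exists>w :: 'q + 's \<Rightarrow> real.
        \<not> (\<exists>c. \<forall>s\<in>alphabet A. w (Inr s) = c) \<and>
        (\<forall>q\<in>states A. \<forall>s\<in>alphabet A.
           w (Inl q) + w (Inr s) = w (Inl (trans_fun A (q, s))) + w (Inr (exit_fun A (q, s)))))"

definition minimal :: "('q, 's) mealy \<Rightarrow> bool" where
  "minimal A \<longleftrightarrow>
     (\<forall>q\<in>states A. \<forall>r\<in>states A. q \<noteq> r \<longrightarrow>
        (\<exists>u\<in>lists (alphabet A). exit_word A q u \<noteq> exit_word A r u))"

text \<open>Intended for \<open>\<sigma> permutes states A\<close>.\<close>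

definition relabel :: "('q \<Rightarrow> 'q) \<Rightarrow> ('q, 's) mealy \<Rightarrow> ('q, 's) mealy" where
  "relabel \<sigma> A =
     \<lparr>states = states A, alphabet = alphabet A,
      trans_fun = (\<lambda>(q, s) \<in> states A \<times> alphabet A. \<sigma> (trans_fun A (inv \<sigma> q, s))),
      exit_fun = (\<lambda>(q, s) \<in> states A \<times> alphabet A. exit_fun A (inv \<sigma> q, s))\<rparr>"

text \<open>\<open>MA m n k l\<close>: the state \<open>q\<^sub>i\<close> is represented by its index \<open>i\<close>. The digits of a number in a given
  base are unique, so the description is definite for \<open>m, n > 0\<close>, \<open>k < m ^ (m * n)\<close>
  and \<open>l < n ^ (m * n)\<close>; nothing is claimed about other arguments.\<close>

definition MA :: "nat \<Rightarrow> nat \<Rightarrow> nat \<Rightarrow> nat \<Rightarrow> (nat, nat) mealy" where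
  "MA m n k l =
     (THE A. A \<in> mealy_automata {..<m} {..<n} \<and>
        k = (\<Sum>i<m. \<Sum>j<n. trans_fun A (i, j) * m ^ (m * n - i * n - j - 1)) \<and>
        l = (\<Sum>i<m. \<Sum>j<n. exit_fun A (i, j) * n ^ (m * n - i * n - j - 1)))"

end

theory Submission
  imports Defs
begin

text \<open>Reading the value tables of the transition and exit functions as binary numbers identifies the
  automata with the pairs of codes \<open>k, l < 16\<close>, so every count is a finite search once the properties
  are decided by the tables. For particle preservation, normalise the weights so that they
  increase by 1 from letter 0 to letter 1 and by \<open>x\<close> from \<open>q\<^sub>0\<close> to \<open>q\<^sub>1\<close>. The condition becomes
  \<open>(i - \<phi>(i, j)) x = \<psi>(i, j) - j\<close> with coefficients in \<open>{-1, 0, 1}\<close>, hence only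
  \<open>x \<in> {-1, 0, 1}\<close> has to be tried.\<close>

section \<open>Value tables and their binary codes\<close>

definition digit :: "nat \<Rightarrow> nat \<Rightarrow> nat \<Rightarrow> nat" where
  "digit k i j = k div 2 ^ (3 - 2 * i - j) mod 2"

text \<open>An explicit counterpart of \<open>MA 2 2 k l\<close>, free of the definite description:
  the bits of weight 8, 4, 2, 1 are the values at (0, 0), (0, 1), (1, 0), (1, 1). Only the four
  lowest bits are read, so every pair of numbers gives an automaton.\<close>

definition aut :: "nat \<Rightarrow> nat \<Rightarrow> (nat, nat) mealy" where
  "aut k l =
     \<lparr>states = {0, 1}, alphabet = {0, 1},
      trans_fun = (\<lambda>(i, j) \<in> {0, 1} \<times> {0, 1}. digit k i j),
      exit_fun = (\<lambda>(i, j) \<in> {0, 1} \<times> {0, 1}. digit l i j)\<rparr>"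

lemma aut_simps [simp]:
  "states (aut k l) = {0, 1}" "alphabet (aut k l) = {0, 1}"
  "i \<in> {0, 1} \<Longrightarrow> j \<in> {0, 1} \<Longrightarrow> trans_fun (aut k l) (i, j) = digit k i j"
  "i \<in> {0, 1} \<Longrightarrow> j \<in> {0, 1} \<Longrightarrow> exit_fun (aut k l) (i, j) = digit l i j"
  by (auto simp: aut_def)

lemma digit_binary: "digit k i j \<in> {0, 1}"
  by (auto simp: digit_def)

lemma digit_eq_1_iff: "digit k i j = 1 \<longleftrightarrow> digit k i j \<noteq> 0"
  using digit_binary[of k i j] by auto

lemma sum_digits:
  assumes "k < 16"
  shows "8 * digit k 0 0 + 4 * digit k 0 1 + 2 * digit k 1 0 + digit k 1 1 = k"
proof -
  have "\<forall>k\<in>set [0..<16]. 8 * digit k 0 0 + 4 * digit k 0 1 + 2 * digit k 1 0 + digit k 1 1 = k"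
    by code_simp
  with assms show ?thesis by simp
qed

lemma digit_unique:
  assumes "k = 8 * a + 4 * b + 2 * c + d" and "{a, b, c, d} \<subseteq> {0, 1}"
  shows "digit k 0 0 = a" "digit k 0 1 = b" "digit k 1 0 = c" "digit k 1 1 = d"
  using assms by (auto simp: digit_def)

lemma aut_in: "aut k l \<in> mealy_automata {0, 1} {0, 1}"
  using digit_eq_1_iff by (auto simp: mealy_automata_def mealy_automaton_def aut_def)

text \<open>Both functions are extensional, so four values determine each of them, and equality of
  records reduces to equality of tables.\<close>

lemma eq_aut_iff:
  assumes "A \<in> mealy_automata {0, 1} {0, 1}"
  shows "A = aut k l \<longleftrightarrow>
    (\<forall>i\<in>{0, 1}. \<forall>j\<in>{0, 1}. trans_fun A (i, j) = digit k i j \<and> exit_fun A (i, j) = digit l i j)"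
proof
  assume R: "\<forall>i\<in>{0, 1}. \<forall>j\<in>{0, 1}. trans_fun A (i, j) = digit k i j \<and> exit_fun A (i, j) = digit l i j"
  have E: "trans_fun A \<in> extensional ({0, 1} \<times> {0, 1})" "exit_fun A \<in> extensional ({0, 1} \<times> {0, 1})"
    using assms by (auto simp: mealy_automata_def mealy_automaton_def PiE_def)
  have "trans_fun A = trans_fun (aut k l)" "exit_fun A = exit_fun (aut k l)"
    by (rule extensionalityI[OF E(1)], simp add: aut_def, use R in auto)
      (rule extensionalityI[OF E(2)], simp add: aut_def, use R in auto)
  then show "A = aut k l"
    using assms by (auto simp: mealy_automata_def intro!: mealy.equality)
qed auto

lemma binary_values:
  assumes "A \<in> mealy_automata {0, 1} {0, 1}" and "i \<in> {0, 1}" and "j \<in> {0, 1}"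
  shows "trans_fun A (i, j) \<in> {0, 1}" "exit_fun A (i, j) \<in> {0, 1}"
proof -
  have "trans_fun A \<in> {0, 1} \<times> {0, 1} \<rightarrow>\<^sub>E {0, 1}" "exit_fun A \<in> {0, 1} \<times> {0, 1} \<rightarrow>\<^sub>E {0, 1}"
    using assms(1) unfolding mealy_automata_def mealy_automaton_def mem_Collect_eq by metis+
  with assms(2,3) show "trans_fun A (i, j) \<in> {0, 1}" "exit_fun A (i, j) \<in> {0, 1}"
    by (meson PiE_mem SigmaI)+
qed

lemma eq_aut_code:
  assumes "A \<in> mealy_automata {0, 1} {0, 1}"
    and "k = 8 * trans_fun A (0, 0) + 4 * trans_fun A (0, 1) + 2 * trans_fun A (1, 0) + trans_fun A (1, 1)"
    and "l = 8 * exit_fun A (0, 0) + 4 * exit_fun A (0, 1) + 2 * exit_fun A (1, 0) + exit_fun A (1, 1)"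
  shows "A = aut k l"
  unfolding eq_aut_iff[OF assms(1)]
  using digit_unique[OF assms(2)] digit_unique[OF assms(3)] binary_values[OF assms(1)] by simp

lemma MA_code_sum:
  fixes h :: "nat \<times> nat \<Rightarrow> nat"
  shows "(\<Sum>i\<in>{0, 1}. \<Sum>j\<in>{0, 1}. h (i, j) * 2 ^ (2 * 2 - i * 2 - j - 1)) =
    8 * h (0, 0) + 4 * h (0, 1) + 2 * h (1, 0) + h (1, 1)"
  by simp

text \<open>The definite description in \<open>MA\<close> has a unique solution:
  \<open>sum_digits\<close> shows that \<open>aut k l\<close> has the required codes, and
  \<open>eq_aut_code\<close> that the codes determine the automaton.\<close>

lemma MA_eq_aut:
  assumes "k < 16" and "l < 16"
  shows "MA 2 2 k l = aut k l"
proof -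
  have two: "{..<2::nat} = {0, 1}"
    by auto
  show ?thesis
    unfolding MA_def two MA_code_sum
  proof (rule the_equality, goal_cases)
    case 1
    show ?case
      by (intro conjI aut_in) (simp_all add: sum_digits[OF assms(1), simplified] sum_digits[OF assms(2), simplified])
  next
    case (2 A)
    then show ?case
      by (intro eq_aut_code) auto
  qed
qed

lemma bij_betw_aut:
  "bij_betw (\<lambda>(k, l). aut k l) ({..<16} \<times> {..<16}) (mealy_automata {0, 1} {0, 1})"
  unfolding bij_betw_def
proof
  show "inj_on (\<lambda>(k, l). aut k l) ({..<16} \<times> {..<16})"
  proof (rule inj_onI, clarify)
    fix k l k' l' :: nat
    assume "k < 16" "l < 16" "k' < 16" "l' < 16" "aut k l = aut k' l'"
    then have "digit k i j = digit k' i j" "digit l i j = digit l' i j"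
      if "i \<in> {0, 1}" "j \<in> {0, 1}" for i j
      using aut_simps(3,4)[OF that, of k l] aut_simps(3,4)[OF that, of k' l'] by simp_all
    then show "k = k' \<and> l = l'"
      using sum_digits[OF \<open>k < 16\<close>] sum_digits[OF \<open>l < 16\<close>]
        sum_digits[OF \<open>k' < 16\<close>] sum_digits[OF \<open>l' < 16\<close>]
      by simp
  qed
  have "A \<in> (\<lambda>(k, l). aut k l) ` ({..<16} \<times> {..<16})"
    if A: "A \<in> mealy_automata {0, 1} {0, 1}" for A
  proof -
    \<comment> \<open>All table entries are at most 1, so each code is at most 8 + 4 + 2 + 1 =
      15.\<close>
    have bin: "trans_fun A (i, j) \<le> 1" "exit_fun A (i, j) \<le> 1" if "i \<in> {0, 1}" "j \<in> {0, 1}" for i j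
      using binary_values[OF A that] by auto
    obtain k l where kl:
      "k = 8 * trans_fun A (0, 0) + 4 * trans_fun A (0, 1) + 2 * trans_fun A (1, 0) + trans_fun A (1, 1)"
      "l = 8 * exit_fun A (0, 0) + 4 * exit_fun A (0, 1) + 2 * exit_fun A (1, 0) + exit_fun A (1, 1)"
      by blast
    have "k < 16" "l < 16"
      unfolding kl using bin[of 0 0] bin[of 0 1] bin[of 1 0] bin[of 1 1] by simp_all
    then have "(k, l) \<in> {..<16} \<times> {..<16}"
      by simp
    then show ?thesis
      by (rule rev_image_eqI) (simp only: prod.case eq_aut_code[OF A kl])
  qed
  with aut_in show "(\<lambda>(k, l). aut k l) ` ({..<16} \<times> {..<16}) = mealy_automata {0, 1} {0, 1}"
    by auto
qed

text \<open>This turns each count into the evaluation of a filter on a list of 256 pairs; since the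
  list is distinct and \<open>aut\<close> is injective on these pairs, its length is the
  cardinality.\<close>

lemma card_automata:
  assumes "\<And>k l. P (aut k l) \<longleftrightarrow> p k l"
  shows "card {A \<in> mealy_automata {0, 1} {0, 1}. P A} =
    length (filter (\<lambda>(k, l). p k l) (List.product [0..<16] [0..<16]))" (is "_ = length ?xs")
proof -
  have "{A \<in> mealy_automata {0, 1} {0, 1}. P A} = (\<lambda>(k, l). aut k l) ` set ?xs"
    using assms unfolding bij_betw_imp_surj_on[OF bij_betw_aut, symmetric] by force
  moreover have "inj_on (\<lambda>(k, l). aut k l) (set ?xs)"
    by (rule inj_on_subset[OF bij_betw_imp_inj_on[OF bij_betw_aut]]) auto
  moreover have "distinct ?xs"
    by (simp add: distinct_product)
  ultimately show ?thesis
    by (simp only: card_image distinct_card)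
qed

section \<open>Deciding the properties from the codes\<close>

definition bijective_code :: "nat \<Rightarrow> nat \<Rightarrow> bool" where
  "bijective_code k l \<longleftrightarrow>
     distinct (map (\<lambda>(i, j). (digit k i j, digit l i j)) [(0, 0), (0, 1), (1, 0), (1, 1)])"

definition transitive_code :: "nat \<Rightarrow> bool" where
  "transitive_code k \<longleftrightarrow> (digit k 0 0 = 1 \<or> digit k 0 1 = 1) \<and> (digit k 1 0 = 0 \<or> digit k 1 1 = 0)"

text \<open>The conservation law for the normalised weights: i * x for state i and j for letter j.
  Integers and explicit lists make it executable.\<close>

definition preserving_code :: "nat \<Rightarrow> nat \<Rightarrow> bool" where
  "preserving_code k l \<longleftrightarrow>
     (\<exists>x\<in>set [-1, 0, 1 :: int]. \<forall>i\<in>set [0, 1]. \<forall>j\<in>set [0, 1].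
        int i * x + int j = int (digit k i j) * x + int (digit l i j))"

text \<open>A self-map of a finite set is bijective as soon as it is injective, so it suffices that
  the four value pairs are distinct.\<close>

lemma bijective_aut_iff: "bijective (aut k l) \<longleftrightarrow> bijective_code k l"
proof -
  let ?f = "\<lambda>(q, s). (trans_fun (aut k l) (q, s), exit_fun (aut k l) (q, s))"
  let ?X = "{0, 1} \<times> {0, 1} :: (nat \<times> nat) set"
  have sub: "?f ` ?X \<subseteq> ?X"
    using digit_eq_1_iff by auto
  have "bijective (aut k l) \<longleftrightarrow> inj_on ?f ?X"
    unfolding bijective_def bij_betw_def aut_simps(1,2) using endo_inj_surj[OF _ sub] by blast
  also have "\<dots> \<longleftrightarrow> inj_on (\<lambda>(i, j). (digit k i j, digit l i j)) ?X"
    by (rule inj_on_cong) auto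
  also have "?X = set [(0, 0), (0, 1), (1, 0), (1, 1)]"
    by auto
  also have "inj_on (\<lambda>(i, j). (digit k i j, digit l i j)) \<dots> \<longleftrightarrow> bijective_code k l"
    unfolding bijective_code_def distinct_map by simp
  finally show ?thesis .
qed

lemma trans_word_fixed:
  assumes "u \<in> lists (alphabet A)" and "\<forall>s\<in>alphabet A. trans_fun A (q, s) = q"
  shows "trans_word A q u = q"
  using assms by (induction u) auto

text \<open>With two states, transitivity means that each state can be left by some letter: a state
  that no letter leaves reaches only itself, and a letter that leaves a state leads to the other
  one.\<close>

lemma transitive_aut_iff: "transitive (aut k l) \<longleftrightarrow> transitive_code k"
proof
  assume T: "transitive (aut k l)"
  have "\<exists>s\<in>{0, 1}. digit k q s \<noteq> q" if q: "q \<in> {0, 1}" for q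
  proof (rule ccontr)
    assume "\<not> ?thesis"
    then have "trans_word (aut k l) q u = q" if "u \<in> lists {0, 1}" for u
      using q that by (intro trans_word_fixed) auto
    \<comment> \<open>\<open>1 - q\<close> is the other state, unreachable from
      \<open>q\<close>.\<close>
    moreover have "1 - q \<in> {0, 1}" "1 - q \<noteq> q"
      using q by auto
    ultimately show False
      using T q unfolding transitive_def by (metis aut_simps(1,2))
  qed
  from this[of 0] this[of 1] show "transitive_code k"
    using digit_binary[of k 0 0] digit_binary[of k 0 1] digit_binary[of k 1 0] digit_binary[of k 1 1]
    by (auto simp: transitive_code_def)
next
  assume "transitive_code k"
  then obtain s t where s: "s \<in> {0, 1}" "digit k 0 s = 1" and t: "t \<in> {0, 1}" "digit k 1 t = 0"
    unfolding transitive_code_def by blast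
  have "\<exists>u\<in>lists {0, 1}. trans_word (aut k l) q u = q'" if "q \<in> {0, 1}" "q' \<in> {0, 1}" for q q'
  proof (cases "q = q'")
    case True
    then show ?thesis by (intro bexI[of _ "[]"]) auto
  next
    case False
    then show ?thesis
      using that s t by (intro bexI[of _ "[if q = 0 then s else t]"]) auto
  qed
  then show "transitive (aut k l)"
    by (simp add: transitive_def)
qed

lemma particle_preserving_aut_iff: "particle_preserving (aut k l) \<longleftrightarrow> preserving_code k l"
proof
  assume "particle_preserving (aut k l)"
  then obtain w :: "nat + nat \<Rightarrow> real" where nc: "\<not> (\<exists>c. \<forall>s\<in>{0, 1}. w (Inr s) = c)"
    and w: "\<forall>i\<in>{0, 1}. \<forall>j\<in>{0, 1}. w (Inl i) + w (Inr j) = w (Inl (digit k i j)) + w (Inr (digit l i j))"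
    unfolding particle_preserving_def aut_simps(1,2) by (metis (no_types, lifting) aut_simps(3,4))
  have ne: "w (Inr 0) \<noteq> w (Inr 1)"
    using nc by auto
  \<comment> \<open>\<open>y\<close> is the weight gap between the letters, nonzero because the
    weight is not constant on them; \<open>x\<close> is the gap between the states in units of
    \<open>y\<close>.\<close>
  define y where "y = w (Inr 1) - w (Inr 0)"
  define x where "x = (w (Inl 1) - w (Inl 0)) / y"
  have "y \<noteq> 0"
    using ne by (simp add: y_def)
  have wl: "w (Inl i) = w (Inl 0) + real i * x * y" "w (Inr i) = w (Inr 0) + real i * y"
    if "i \<in> {0, 1}" for i
    using that \<open>y \<noteq> 0\<close> by (auto simp: x_def) (simp add: y_def)
  have x: "real i * x + real j = real (digit k i j) * x + real (digit l i j)"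
    if "i \<in> {0, 1}" "j \<in> {0, 1}" for i j
  proof -
    have "(real i * x + real j) * y = (real (digit k i j) * x + real (digit l i j)) * y"
      using w that wl(1)[OF that(1)] wl(2)[OF that(2)] wl(1)[OF digit_binary, of k i j]
        wl(2)[OF digit_binary, of l i j]
      by (auto simp: algebra_simps)
    with \<open>y \<noteq> 0\<close> show ?thesis by simp
  qed
  have "\<exists>z\<in>{-1, 0, 1 :: int}. \<forall>i\<in>{0, 1}. \<forall>j\<in>{0, 1}.
      real i * real_of_int z + real j = real (digit k i j) * real_of_int z + real (digit l i j)"
  proof (cases "\<forall>i\<in>{0, 1}. \<forall>j\<in>{0, 1}. digit k i j = i")
    \<comment> \<open>No transition changes the state, so the terms with \<open>x\<close> cancel and
      0 serves as well.\<close>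
    case True
    with x show ?thesis by (intro bexI[of _ 0]) auto
  next
    case False
    then obtain i j where ij: "i \<in> {0, 1}" "j \<in> {0, 1}" "digit k i j \<noteq> i"
      by blast
    \<comment> \<open>Here the coefficient of \<open>x\<close> is 1 or -1, so \<open>x\<close> is,
      up to sign, a difference of two letters.\<close>
    have "x \<in> {-1, 0, 1}"
      using x[OF ij(1,2)] ij digit_binary[of k i j] digit_binary[of l i j] by auto
    then obtain z :: int where "z \<in> {-1, 0, 1}" "x = real_of_int z"
      by force
    with x show ?thesis by blast
  qed
  then obtain z :: int where z: "z \<in> {-1, 0, 1}" and e: "\<forall>i\<in>{0, 1}. \<forall>j\<in>{0, 1}.
      real i * real_of_int z + real j = real (digit k i j) * real_of_int z + real (digit l i j)"
    by blast
  have "int i * z + int j = int (digit k i j) * z + int (digit l i j)"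
    if "i \<in> {0, 1}" "j \<in> {0, 1}" for i j
  proof -
    have "real_of_int (int i * z + int j) = real_of_int (int (digit k i j) * z + int (digit l i j))"
      using e that by auto
    then show ?thesis by (simp only: of_int_eq_iff)
  qed
  with z show "preserving_code k l"
    unfolding preserving_code_def by (intro bexI[of _ z]) auto
next
  assume "preserving_code k l"
  then obtain x :: int where x: "\<forall>i\<in>set [0, 1]. \<forall>j\<in>set [0, 1].
      int i * x + int j = int (digit k i j) * x + int (digit l i j)"
    unfolding preserving_code_def by blast
  define w :: "nat + nat \<Rightarrow> real" where "w = case_sum (\<lambda>i. real_of_int (int i * x)) real"
  have "w (Inl i) + w (Inr j) = w (Inl (digit k i j)) + w (Inr (digit l i j))"
    if "i \<in> {0, 1}" "j \<in> {0, 1}" for i j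
  proof -
    have "int i * x + int j = int (digit k i j) * x + int (digit l i j)"
      using x that by auto
    from arg_cong[OF this, of real_of_int] show ?thesis by (simp add: w_def)
  qed
  moreover have "\<not> (\<exists>c. \<forall>s\<in>{0, 1}. w (Inr s) = c)"
    by (auto simp: w_def)
  ultimately show "particle_preserving (aut k l)"
    unfolding particle_preserving_def by (intro exI[of _ w]) auto
qed

section \<open>Identical action, minimality and exchange of the states\<close>

lemma acts_identicallyI:
  assumes "mealy_automaton A"
    and "\<And>q s. q \<in> states A \<Longrightarrow> s \<in> alphabet A \<Longrightarrow> exit_fun A (q, s) = s"
  shows "acts_identically A"
proof -
  have "exit_word A q u = u" if "u \<in> lists (alphabet A)" "q \<in> states A" for q u
    using that
  proof (induction u arbitrary: q)
    case (Cons s u)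
    then have "trans_fun A (q, s) \<in> states A"
      using assms(1) by (auto simp: mealy_automaton_def PiE_def)
    with Cons assms(2) show ?case by simp
  qed simp
  then show ?thesis
    by (simp add: acts_identically_def)
qed

lemma acts_identically_not_minimal:
  assumes "acts_identically A" and "q \<in> states A" and "r \<in> states A" and "q \<noteq> r"
  shows "\<not> minimal A"
  using assms unfolding acts_identically_def minimal_def by metis

text \<open>In binary, 5 is 0101, the exit table that copies the letter in both states, whatever the
  transitions are.\<close>

lemma aut_5_acts_identically: "acts_identically (aut k 5)"
proof (rule acts_identicallyI)
  show "mealy_automaton (aut k 5)"
    using aut_in[of k 5] by (simp add: mealy_automata_def)
qed (auto simp: digit_def)

lemma aut_5_not_minimal: "\<not> minimal (aut k 5)"
  by (rule acts_identically_not_minimal[OF aut_5_acts_identically, of 0 _ 1]) auto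

text \<open>The one-letter word 0 already separates the two states.\<close>

lemma minimal_autI:
  assumes "digit l 0 0 \<noteq> digit l 1 0"
  shows "minimal (aut k l)"
  using assms unfolding minimal_def by (auto intro!: bexI[of _ "[0]"])

lemma relabel_aut_in: "relabel (Transposition.transpose 0 1) (aut k l) \<in> mealy_automata {0, 1} {0, 1}"
  using digit_eq_1_iff
  by (auto simp: relabel_def mealy_automata_def mealy_automaton_def transpose_def)

text \<open>The exchange swaps the rows of both tables and complements the transition values: 01|01
  becomes 10|10, that is 5 becomes 10, and the exit table 00|11 becomes 11|00, that is 3 becomes
  12.\<close>

lemma relabel_aut:
  "relabel (Transposition.transpose 0 1) (aut 5 3) = aut 10 12"
  "relabel (Transposition.transpose 0 1) (aut 10 12) = aut 5 3"
  unfolding eq_aut_iff[OF relabel_aut_in]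
  by (simp_all add: relabel_def digit_def)

section \<open>The counts and the classification\<close>

theorem mainTheorem2:
  fixes Q S :: "nat set" and \<A> :: "(nat, nat) mealy set" and exchange :: "nat \<Rightarrow> nat"
  assumes "Q = {0, 1}" and "S = {0, 1}" and "\<A> = mealy_automata Q S"
    and "exchange = Transposition.transpose 0 1"
  shows "card \<A> = 256 \<and>
    card {A \<in> \<A>. bijective A} = 24 \<and>
    card {A \<in> \<A>. bijective A \<and> transitive A} = 20 \<and>
    card {A \<in> \<A>. bijective A \<and> particle_preserving A} = 6 \<and>
    card {A \<in> \<A>. bijective A \<and> transitive A \<and> particle_preserving A} = 5 \<and>
    {A \<in> \<A>. bijective A \<and> transitive A \<and> particle_preserving A} =
      {MA 2 2 5 3, MA 2 2 6 5, MA 2 2 9 5, MA 2 2 10 12, MA 2 2 12 5} \<and>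
    (\<forall>A \<in> {MA 2 2 6 5, MA 2 2 9 5, MA 2 2 12 5}. acts_identically A \<and> \<not> minimal A) \<and>
    minimal (MA 2 2 5 3) \<and> minimal (MA 2 2 10 12) \<and>
    MA 2 2 10 12 = relabel exchange (MA 2 2 5 3) \<and>
    MA 2 2 5 3 = relabel exchange (MA 2 2 10 12) \<and>
    (\<forall>A \<in> \<A>. bijective A \<and> transitive A \<and> particle_preserving A \<and> minimal A \<longleftrightarrow>
      A = MA 2 2 5 3 \<or> A = relabel exchange (MA 2 2 5 3))"
proof -
  have A: "\<A> = mealy_automata {0, 1} {0, 1}"
    by (simp only: assms)
  note card = card_automata[folded A]
  have MA: "MA 2 2 5 3 = aut 5 3" "MA 2 2 6 5 = aut 6 5" "MA 2 2 9 5 = aut 9 5"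
    "MA 2 2 10 12 = aut 10 12" "MA 2 2 12 5 = aut 12 5"
    by (simp_all add: MA_eq_aut)
  have c256: "card \<A> = 256"
    using bij_betw_same_card[OF bij_betw_aut] by (simp add: A)
  have c24: "card {A \<in> \<A>. bijective A} = 24"
    by (subst card[where p = bijective_code], rule bijective_aut_iff) code_simp
  have c20: "card {A \<in> \<A>. bijective A \<and> transitive A} = 20"
    by (subst card[where p = "\<lambda>k l. bijective_code k l \<and> transitive_code k"],
        simp only: bijective_aut_iff transitive_aut_iff) code_simp
  have c6: "card {A \<in> \<A>. bijective A \<and> particle_preserving A} = 6"
    by (subst card[where p = "\<lambda>k l. bijective_code k l \<and> preserving_code k l"],
        simp only: bijective_aut_iff particle_preserving_aut_iff) code_simp
  let ?p = "\<lambda>k l. bijective_code k l \<and> transitive_code k \<and> preserving_code k l"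
  have p_iff: "bijective (aut k l) \<and> transitive (aut k l) \<and> particle_preserving (aut k l) \<longleftrightarrow> ?p k l" for k l
    by (simp only: bijective_aut_iff transitive_aut_iff particle_preserving_aut_iff)
  \<comment> \<open>The search returns the pairs themselves, which yields both the number 5 and the
    explicit set.\<close>
  have codes: "filter (\<lambda>(k, l). ?p k l) (List.product [0..<16] [0..<16]) =
      [(5, 3), (6, 5), (9, 5), (10, 12), (12, 5)]" (is "?xs = ?ys")
    by code_simp
  have c5: "card {A \<in> \<A>. bijective A \<and> transitive A \<and> particle_preserving A} = 5"
    by (subst card[where p = ?p, OF p_iff], subst codes) simp
  have "{A \<in> \<A>. bijective A \<and> transitive A \<and> particle_preserving A} = (\<lambda>(k, l). aut k l) ` set ?xs"
    unfolding A bij_betw_imp_surj_on[OF bij_betw_aut, symmetric] using p_iff by force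
  also have "\<dots> = {MA 2 2 5 3, MA 2 2 6 5, MA 2 2 9 5, MA 2 2 10 12, MA 2 2 12 5}"
    unfolding codes MA by simp
  finally have set5: "{A \<in> \<A>. bijective A \<and> transitive A \<and> particle_preserving A} =
    {MA 2 2 5 3, MA 2 2 6 5, MA 2 2 9 5, MA 2 2 10 12, MA 2 2 12 5}" .
  have ident: "\<forall>A \<in> {MA 2 2 6 5, MA 2 2 9 5, MA 2 2 12 5}. acts_identically A \<and> \<not> minimal A"
    using aut_5_acts_identically aut_5_not_minimal by (simp add: MA)
  have min: "minimal (MA 2 2 5 3)" "minimal (MA 2 2 10 12)"
    unfolding MA by (auto intro!: minimal_autI simp: digit_def)
  have exch: "MA 2 2 10 12 = relabel exchange (MA 2 2 5 3)"
    "MA 2 2 5 3 = relabel exchange (MA 2 2 10 12)"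
    by (simp_all only: MA assms(4) relabel_aut)
  \<comment> \<open>Of the five automata, the three with exit code 5 are not minimal; the other two
    are minimal and form one orbit under the exchange.\<close>
  have "\<forall>A \<in> \<A>. bijective A \<and> transitive A \<and> particle_preserving A \<and> minimal A \<longleftrightarrow>
      A = MA 2 2 5 3 \<or> A = relabel exchange (MA 2 2 5 3)"
    unfolding exch(1)[symmetric] using set5 ident min by blast
  with c256 c24 c20 c6 c5 set5 ident min exch show ?thesis
    by (intro conjI)
qed

end
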